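(* Let $G$ be a finite simple graph of order $n$ with $m$ edges and minimum degree $\delta$, let $k\geq 0$ and $t\geq 1$ be integers, $h=k+1$ and $s=\mathrm{sp}(G,k)$. Let $n_j$ be the number of vertices of degree $j$ in $G$, and for $i\ge 0$ let $W_i=\sum_{j=\delta+ih}^{\delta+ih+k}n_j$. (i) Equality holds in the inequality $$\mathrm{sp}(G,k)\ \geq\ \frac{2\left( n(\delta+th)-2m+\sum_{v\in V(G)}\varepsilon_{t}(\deg(v))\right)}{h\,t(t+1)}$$ if and only if $W_0=W_1=\cdots=W_{t-1}=s$. (ii) Equality holds in the inequality $\mathrm{sp}(G,k)\geq f_t$, that is $s=f_t$, if and only if every degree of $G$ lies in $\{\delta,\delta+h,\ldots,\delta+th\}$ and $$n_\delta=n_{\delta+h}=\cdots=n_{\delta+(t-1)h}=s,\qquad n_{\delta+th}=n-ts\leq s.$$ In particular, equality forces $s=f_t$ to be an integer with $n/(t+1)\leq s\leq n/t$, and $t-1\leq 2x\leq t$.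
   Context: For a graph $G$ and $B\subseteq V(G)$ the spread is $\mathrm{sp}(B)=\max_{u\in B}\deg_G(u)-\min_{v\in B}\deg_G(v)$, and $\mathrm{sp}(G,k)$ is the largest cardinality of a set $B\subseteq V(G)$ with $\mathrm{sp}(B)\leq k$. For $i\geq 0$ let $I_i=\{\delta+ih,\ldots,\delta+ih+k\}$, and let $\mu(y,i)=1$ if $y\in I_i$ and $0$ otherwise. For integers $t\ge1$, $y\geq\delta$ put $u_t(y)=\sum_{i=0}^{t-1}(t-i)\mu(y,i)$ and $\varepsilon_t(y)=h\,u_t(y)-(\delta+th-y)$. With $d=2m/n$ and $x=(d-\delta)/h$, $$f_t=f_t(n,m,\delta,k)=\frac{2\left(n(\delta+th)-2m\right)}{h\,t(t+1)}=\frac{2n(t-x)}{t(t+1)}.$$ Both inequalities in (i) and (ii) hold for every graph $G$. *)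

theory Defs
  imports Complex_Main
begin

definition simple_graph :: "'a set \<Rightarrow> 'a set set \<Rightarrow> bool" where
  "simple_graph V E \<longleftrightarrow> finite V \<and> (\<forall>e\<in>E. e \<subseteq> V \<and> card e = 2)"

definition degree :: "'a set set \<Rightarrow> 'a \<Rightarrow> nat" where
  "degree E v = card {e \<in> E. v \<in> e}"

definition min_degree :: "'a set \<Rightarrow> 'a set set \<Rightarrow> nat" where
  "min_degree V E = Min (degree E ` V)"

definition num_of_degree :: "'a set \<Rightarrow> 'a set set \<Rightarrow> nat \<Rightarrow> nat" where
  "num_of_degree V E j = card {v \<in> V. degree E v = j}"

definition spread :: "'a set set \<Rightarrow> 'a set \<Rightarrow> nat" where
  "spread E B = Max (degree E ` B) - Min (degree E ` B)"

(* Max and Min are unspecified on the empty set, so B ranges over nonempty sets only. For V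
   nonempty this does not affect the maximum: singletons have spread 0. *)
definition spread_number :: "'a set \<Rightarrow> 'a set set \<Rightarrow> nat \<Rightarrow> nat" where
  "spread_number V E k = Max {card B | B. B \<subseteq> V \<and> B \<noteq> {} \<and> spread E B \<le> k}"

definition window :: "nat \<Rightarrow> nat \<Rightarrow> nat \<Rightarrow> nat set" where
  "window \<delta> k i = {\<delta> + i * (k + 1) .. \<delta> + i * (k + 1) + k}"

definition window_count :: "'a set \<Rightarrow> 'a set set \<Rightarrow> nat \<Rightarrow> nat \<Rightarrow> nat \<Rightarrow> nat" where
  "window_count V E \<delta> k i = (\<Sum>j\<in>window \<delta> k i. num_of_degree V E j)"

definition mu :: "nat \<Rightarrow> nat \<Rightarrow> nat \<Rightarrow> nat \<Rightarrow> nat" where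
  "mu \<delta> k y i = (if y \<in> window \<delta> k i then 1 else 0)"

definition u :: "nat \<Rightarrow> nat \<Rightarrow> nat \<Rightarrow> nat \<Rightarrow> nat" where
  "u \<delta> k t y = (\<Sum>i<t. (t - i) * mu \<delta> k y i)"

definition eps :: "nat \<Rightarrow> nat \<Rightarrow> nat \<Rightarrow> nat \<Rightarrow> int" where
  "eps \<delta> k t y = int (k + 1) * int (u \<delta> k t y) - (int \<delta> + int t * int (k + 1) - int y)"

definition f_bound :: "nat \<Rightarrow> nat \<Rightarrow> nat \<Rightarrow> nat \<Rightarrow> nat \<Rightarrow> real" where
  "f_bound n m \<delta> k t =
     2 * (real n * (real \<delta> + real t * real (k + 1)) - 2 * real m)
       / (real (k + 1) * real t * (real t + 1))"

definition x_param :: "nat \<Rightarrow> nat \<Rightarrow> nat \<Rightarrow> nat \<Rightarrow> real" where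
  "x_param n m \<delta> k = (2 * real m / real n - real \<delta>) / real (k + 1)"

lemma f_bound_eq_x_param:
  assumes "n > 0"
  shows "f_bound n m \<delta> k t = 2 * real n * (real t - x_param n m \<delta> k) / (real t * (real t + 1))"
proof -
  define h where "h = real (k + 1)"
  have h: "h > 0" by (simp add: h_def)
  have "real n * (real \<delta> + real t * h) - 2 * real m
      = h * (real n * (real t - (2 * real m / real n - real \<delta>) / h))"
    using assms h by (simp add: field_simps)
  then show ?thesis
    using h unfolding f_bound_def x_param_def h_def[symmetric] by simp
qed

end

theory Submission
  imports Defs
begin

text \<open>By the handshake lemma and double counting, the numerator of the first bound is
  \<open>2 h (\<Sum>i<t. (t - i) W\<^sub>i)\<close>. Each \<open>W\<^sub>i\<close> is at most \<open>s\<close> and the weights \<open>t - i\<close> are positive with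
  sum \<open>t (t + 1) / 2\<close>, so equality means that every \<open>W\<^sub>i\<close> equals \<open>s\<close>. If \<open>y = \<delta> + q h + r\<close> with
  \<open>r < h\<close>, then \<open>\<epsilon>\<^sub>t(y)\<close> is \<open>r\<close> for \<open>q < t\<close> and \<open>y - (\<delta> + t h)\<close> otherwise; it is therefore nonnegative
  and vanishes exactly on \<open>{\<delta>, \<delta> + h, \<dots>, \<delta> + t h}\<close>. Hence \<open>s = f\<^sub>t\<close> is equality in the first bound
  together with the vanishing of all \<open>\<epsilon>\<^sub>t(deg v)\<close>.\<close>

section \<open>Finiteness and the handshake lemma\<close>

lemma simple_graph_finite:
  assumes "simple_graph V E"
  shows "finite V" "finite E"
proof -
  show V: "finite V" using assms by (simp add: simple_graph_def)
  have "E \<subseteq> Pow V" using assms by (auto simp: simple_graph_def)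
  then show "finite E" using V by (meson finite_Pow_iff finite_subset)
qed

lemma handshake:
  assumes "simple_graph V E"
  shows "(\<Sum>v\<in>V. degree E v) = 2 * card E"
proof -
  note fin = simple_graph_finite[OF assms]
  have "(\<Sum>v\<in>V. degree E v) = (\<Sum>v\<in>V. \<Sum>e | e \<in> E \<and> v \<in> e. 1)"
    by (simp add: degree_def)
  also have "\<dots> = (\<Sum>e\<in>E. \<Sum>v | v \<in> V \<and> v \<in> e. 1)"
    by (rule sum.swap_restrict) (use fin in auto)
  also have "\<dots> = (\<Sum>e\<in>E. 2)"
  proof (rule sum.cong)
    fix e assume "e \<in> E"
    then have "e \<subseteq> V" "card e = 2" using assms by (auto simp: simple_graph_def)
    \<comment> \<open>All of \<open>e\<close> lies in \<open>V\<close>, so the edge is counted once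
      at each of its two ends.\<close>
    moreover from this have "{v. v \<in> V \<and> v \<in> e} = e" by auto
    ultimately show "(\<Sum>v | v \<in> V \<and> v \<in> e. 1) = (2::nat)" by simp
  qed simp
  finally show ?thesis by simp
qed

section \<open>Degree windows and the spread number\<close>

lemma min_degree_le:
  assumes "finite V" "v \<in> V"
  shows "min_degree V E \<le> degree E v"
  using assms by (simp add: min_degree_def)

lemma window_count_eq_card:
  assumes "finite V"
  shows "window_count V E \<delta> k i = card {v \<in> V. degree E v \<in> window \<delta> k i}"
proof -
  have "window_count V E \<delta> k i = card (\<Union>j\<in>window \<delta> k i. {v \<in> V. degree E v = j})"
    unfolding window_count_def num_of_degree_def
    by (rule card_UN_disjoint[symmetric]) (use assms in \<open>auto simp: window_def\<close>)
  also have "(\<Union>j\<in>window \<delta> k i. {v \<in> V. degree E v = j}) = {v \<in> V. degree E v \<in> window \<delta> k i}"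
    by auto
  finally show ?thesis .
qed

lemma card_le_spread_number:
  assumes "finite V" "B \<subseteq> V" "B \<noteq> {}" "spread E B \<le> k"
  shows "card B \<le> spread_number V E k"
  unfolding spread_number_def
proof (rule Max_ge)
  \<comment> \<open>\<open>Max_ge\<close> needs a finite set; the candidates are among the sizes of
    subsets of \<open>V\<close>.\<close>
  have "{card B |B. B \<subseteq> V \<and> B \<noteq> {} \<and> spread E B \<le> k} \<subseteq> card ` Pow V" by auto
  then show "finite {card B |B. B \<subseteq> V \<and> B \<noteq> {} \<and> spread E B \<le> k}"
    by (rule finite_subset) (use assms(1) in simp)
qed (use assms in auto)

text \<open>Two degrees in the same window differ by at most \<open>k\<close>, so the vertices
  counted by a window are a candidate set for \<open>spread_number\<close>. An empty window is
  treated apart, since \<open>spread\<close> reads \<open>Max\<close> and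
  \<open>Min\<close>.\<close>

lemma window_count_le:
  assumes "finite V"
  shows "window_count V E \<delta> k i \<le> spread_number V E k"
proof -
  define B where "B = {v \<in> V. degree E v \<in> window \<delta> k i}"
  have B: "B \<subseteq> V" "finite B" using assms by (auto simp: B_def)
  have "card B \<le> spread_number V E k"
  proof (cases "B = {}")
    case False
    have "Max (degree E ` B) \<in> degree E ` B" "Min (degree E ` B) \<in> degree E ` B"
      using False B by auto
    then have "Max (degree E ` B) \<in> window \<delta> k i" "Min (degree E ` B) \<in> window \<delta> k i"
      by (auto simp: B_def)
    then have "spread E B \<le> k" by (auto simp: spread_def window_def)
    with False show ?thesis using card_le_spread_number assms B by blast
  qed simp
  then show ?thesis by (simp add: window_count_eq_card[OF assms] B_def)
qed

section \<open>Values and zeros of \<open>eps\<close>\<close>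

lemma mem_window_iff:
  assumes "\<delta> \<le> y"
  shows "y \<in> window \<delta> k i \<longleftrightarrow> i = (y - \<delta>) div (k + 1)"
proof
  assume "y \<in> window \<delta> k i"
  \<comment> \<open>The top of window \<open>i\<close> is one below the start of window
    \<open>i + 1\<close>, so the windows tile the integers from \<delta> on and the index is a
    quotient.\<close>
  then have "i * (k + 1) \<le> y - \<delta>" "y - \<delta> < Suc i * (k + 1)"
    by (auto simp: window_def)
  then show "i = (y - \<delta>) div (k + 1)"
    using div_nat_eqI[of "k + 1" i "y - \<delta>"] by (simp add: mult.commute)
next
  assume i: "i = (y - \<delta>) div (k + 1)"
  have "y - \<delta> = i * (k + 1) + (y - \<delta>) mod (k + 1)"
    unfolding i by (rule div_mult_mod_eq[symmetric])
  moreover have "(y - \<delta>) mod (k + 1) \<le> k" using mod_less_divisor[of "k + 1" "y - \<delta>"] by simp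
  ultimately show "y \<in> window \<delta> k i" using assms unfolding window_def atLeastAtMost_iff by linarith
qed

text \<open>The truncated subtraction is intended: beyond the first \<open>t\<close> windows the value is \<open>0\<close>.\<close>
lemma u_eq:
  assumes "\<delta> \<le> y"
  shows "u \<delta> k t y = t - (y - \<delta>) div (k + 1)"
proof -
  have "u \<delta> k t y = (\<Sum>i<t. if i = (y - \<delta>) div (k + 1) then t - i else 0)"
    unfolding u_def mu_def mem_window_iff[OF assms] by (rule sum.cong) auto
  then show ?thesis by (simp add: sum.delta)
qed

text \<open>Write y = \<delta> + q h + r with h = \<open>k + 1\<close>. For q < t,
  \<open>u_eq\<close> gives t - q, and h (t - q) - (\<delta> + t h - y) collapses to r. For q \<ge>
  t it gives 0, which leaves y - (\<delta> + t h).\<close>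

lemma eps_eq:
  assumes "\<delta> \<le> y"
  shows "eps \<delta> k t y =
    (if y < \<delta> + t * (k + 1) then int ((y - \<delta>) mod (k + 1)) else int y - int (\<delta> + t * (k + 1)))"
proof -
  define q r where "q = (y - \<delta>) div (k + 1)" and "r = (y - \<delta>) mod (k + 1)"
  have y: "y = \<delta> + q * (k + 1) + r"
    using assms div_mult_mod_eq[of "y - \<delta>" "k + 1"] unfolding q_def r_def by linarith
  have q: "q < t \<longleftrightarrow> y < \<delta> + t * (k + 1)"
    using assms by (auto simp: q_def less_mult_imp_div_less dest: div_less_iff_less_mult[THEN iffD1, rotated])
  show ?thesis
  proof (cases "q < t")
    case True
    then have "eps \<delta> k t y = int (k + 1) * (int t - int q) - (int \<delta> + int t * int (k + 1) - int y)"
      unfolding eps_def u_eq[OF assms] q_def[symmetric] by (simp add: of_nat_diff)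
    also have "\<dots> = int r" unfolding y by (simp add: algebra_simps)
    finally show ?thesis using True q by (simp add: r_def)
  next
    case False
    then have "eps \<delta> k t y = - (int \<delta> + int t * int (k + 1) - int y)"
      unfolding eps_def u_eq[OF assms] q_def[symmetric] by simp
    then show ?thesis using False q by (simp add: algebra_simps)
  qed
qed

lemma eps_nonneg:
  assumes "\<delta> \<le> y"
  shows "eps \<delta> k t y \<ge> 0"
proof (cases "y < \<delta> + t * (k + 1)")
  case False
  then have "int (\<delta> + t * (k + 1)) \<le> int y" by (simp only: of_nat_le_iff not_less)
  then show ?thesis unfolding eps_eq[OF assms] using False by (simp only: if_False)
qed (simp add: eps_eq[OF assms])

lemma eps_eq_0_iff:
  assumes "\<delta> \<le> y"
  shows "eps \<delta> k t y = 0 \<longleftrightarrow> y \<in> {\<delta> + i * (k + 1) | i. i \<le> t}"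
proof
  assume eps: "eps \<delta> k t y = 0"
  show "y \<in> {\<delta> + i * (k + 1) | i. i \<le> t}"
  proof (cases "y < \<delta> + t * (k + 1)")
    case True
    with eps have "(y - \<delta>) mod (k + 1) = 0" by (simp add: eps_eq[OF assms])
    then obtain i where "y - \<delta> = i * (k + 1)" by (metis mod_0_imp_dvd dvdE mult.commute)
    then have y: "y = \<delta> + i * (k + 1)" using assms by linarith
    with True have "i * (k + 1) < t * (k + 1)" by linarith
    then have "i < t" using mult_less_cancel2 by blast
    with y show ?thesis by fastforce
  next
    case False
    with eps have "y = \<delta> + t * (k + 1)" unfolding eps_eq[OF assms] by (simp only: if_False)
    then show ?thesis by blast
  qed
next
  assume "y \<in> {\<delta> + i * (k + 1) | i. i \<le> t}"
  then obtain i where y: "y = \<delta> + i * (k + 1)" and "i \<le> t" by blast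
  then have "y \<le> \<delta> + t * (k + 1)" by (metis add_left_mono mult_le_mono1)
  moreover have "(y - \<delta>) mod (k + 1) = 0" unfolding y add_diff_cancel_left' by (rule mod_mult_self2_is_0)
  \<comment> \<open>Below \<delta> + t h the remainder is 0; otherwise y equals \<delta> + t h and
    the second branch of \<open>eps_eq\<close> vanishes.\<close>
  ultimately show "eps \<delta> k t y = 0" unfolding eps_eq[OF assms] by auto
qed

section \<open>Double counting and the weighted sum of window counts\<close>

lemma sum_u_eq_window_counts:
  assumes "finite V"
  shows "(\<Sum>v\<in>V. u \<delta> k t (degree E v)) = (\<Sum>i<t. (t - i) * window_count V E \<delta> k i)"
proof -
  have "(\<Sum>v\<in>V. mu \<delta> k (degree E v) i) = window_count V E \<delta> k i" for i
    using assms by (simp add: mu_def window_count_eq_card sum.If_cases Int_def)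
  moreover have "(\<Sum>v\<in>V. u \<delta> k t (degree E v)) = (\<Sum>i<t. (t - i) * (\<Sum>v\<in>V. mu \<delta> k (degree E v) i))"
    unfolding u_def by (subst sum.swap) (simp add: sum_distrib_left)
  ultimately show ?thesis by simp
qed

text \<open>Summing the definition of \<open>eps\<close> over \<open>V\<close> turns the terms y
  into the degree sum, which is twice the number of edges, and the terms \<open>u\<close> into
  window counts. The identity lives in \<open>int\<close> because the difference on the left may be
  negative before \<open>eps\<close> is added.\<close>

lemma sum_eps_eq:
  assumes "simple_graph V E"
  shows "int (card V) * (int \<delta> + int t * int (k + 1)) - 2 * int (card E)
           + (\<Sum>v\<in>V. eps \<delta> k t (degree E v))
         = int (k + 1) * (\<Sum>i<t. int ((t - i) * window_count V E \<delta> k i))"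
proof -
  have "(\<Sum>v\<in>V. eps \<delta> k t (degree E v))
      = int (k + 1) * int (\<Sum>v\<in>V. u \<delta> k t (degree E v))
        - (int (card V) * (int \<delta> + int t * int (k + 1)) - int (\<Sum>v\<in>V. degree E v))"
    unfolding eps_def by (simp only: sum_subtractf sum_distrib_left[symmetric] of_nat_sum sum_constant)
  then show ?thesis
    unfolding handshake[OF assms] sum_u_eq_window_counts[OF simple_graph_finite(1)[OF assms]] by simp
qed

lemma sum_descending_weights: "2 * (\<Sum>i<t. t - i) = t * (t + 1 :: nat)"
proof -
  have "(\<Sum>i<t. t - i) = (\<Sum>i<t. Suc i)"
    by (rule sum.reindex_bij_witness[of _ "\<lambda>i. t - Suc i" "\<lambda>i. t - Suc i"]) auto
  moreover have "2 * (\<Sum>i<t. Suc i) = t * (t + 1)" by (induction t) auto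
  ultimately show ?thesis by simp
qed

text \<open>Compare term by term with the constant family \<open>s\<close>. All weights
  \<open>t - i\<close> with \<open>i < t\<close> are positive, so equal sums force every
  \<open>W i\<close> to be \<open>s\<close>.\<close>

lemma weighted_sum_bound:
  fixes W :: "nat \<Rightarrow> nat"
  assumes "\<And>i. i < t \<Longrightarrow> W i \<le> s"
  shows "2 * (\<Sum>i<t. (t - i) * W i) \<le> s * (t * (t + 1))"
    and "2 * (\<Sum>i<t. (t - i) * W i) = s * (t * (t + 1)) \<longleftrightarrow> (\<forall>i<t. W i = s)"
proof -
  have eq: "s * (t * (t + 1)) = 2 * (\<Sum>i<t. (t - i) * s)"
    using sum_descending_weights[of t] by (simp add: sum_distrib_right[symmetric] mult.assoc[symmetric])
  have le: "(t - i) * W i \<le> (t - i) * s" if "i \<in> {..<t}" for i using assms that by simp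
  show "2 * (\<Sum>i<t. (t - i) * W i) \<le> s * (t * (t + 1))"
    unfolding eq using sum_mono[of "{..<t}", OF le] by simp
  show "2 * (\<Sum>i<t. (t - i) * W i) = s * (t * (t + 1)) \<longleftrightarrow> (\<forall>i<t. W i = s)"
  proof
    assume "2 * (\<Sum>i<t. (t - i) * W i) = s * (t * (t + 1))"
    then have "(\<Sum>i<t. (t - i) * W i) = (\<Sum>i<t. (t - i) * s)" unfolding eq by simp
    from sum_mono_inv[OF this le] show "\<forall>i<t. W i = s" by force
  qed (unfold eq, simp)
qed

section \<open>The equality cases\<close>

theorem proposition5:
  fixes V :: "'a set" and E :: "'a set set" and n m \<delta> k t h s :: nat
  assumes "simple_graph V E" and "V \<noteq> {}"
    and "n = card V" and "m = card E" and "\<delta> = min_degree V E"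
    and "t \<ge> 1" and "h = k + 1" and "s = spread_number V E k"
  shows
    "(real s = 2 * (real n * (real \<delta> + real t * real h) - 2 * real m
                     + (\<Sum>v\<in>V. real_of_int (eps \<delta> k t (degree E v))))
                 / (real h * real t * (real t + 1))
        \<longleftrightarrow> (\<forall>i<t. window_count V E \<delta> k i = s))
     \<and> (real s = f_bound n m \<delta> k t
        \<longleftrightarrow> (\<forall>v\<in>V. degree E v \<in> {\<delta> + i * h | i. i \<le> t})
            \<and> (\<forall>i<t. num_of_degree V E (\<delta> + i * h) = s)
            \<and> int (num_of_degree V E (\<delta> + t * h)) = int n - int t * int s
            \<and> int n - int t * int s \<le> int s)
     \<and> (real s = f_bound n m \<delta> k t
        \<longrightarrow> f_bound n m \<delta> k t \<in> \<int>
            \<and> real n / (real t + 1) \<le> real s \<and> real s \<le> real n / real t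
            \<and> real t - 1 \<le> 2 * x_param n m \<delta> k \<and> 2 * x_param n m \<delta> k \<le> real t)"
proof -
  note fin = simple_graph_finite(1)[OF assms(1)]
  have npos: "n > 0" using assms(2,3) fin by (simp add: card_gt_0_iff)
  define W where "W = window_count V E \<delta> k"
  define S where "S = (\<Sum>i<t. (t - i) * W i)"
  define D where "D = (\<Sum>v\<in>V. eps \<delta> k t (degree E v))"
  define N where "N = int n * (int \<delta> + int t * int h) - 2 * int m"
  have W_le: "W i \<le> s" for i
    unfolding W_def assms(8) by (rule window_count_le[OF fin])
  have deg_ge: "\<delta> \<le> degree E v" if "v \<in> V" for v
    unfolding assms(5) using min_degree_le[OF fin that] .
  have eps_ge: "eps \<delta> k t (degree E v) \<ge> 0" if "v \<in> V" for v
    using eps_nonneg deg_ge that by blast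
  have D_nonneg: "D \<ge> 0" unfolding D_def using eps_ge by (rule sum_nonneg)
  have D_0: "D = 0 \<longleftrightarrow> (\<forall>v\<in>V. degree E v \<in> {\<delta> + i * h | i. i \<le> t})"
    unfolding D_def assms(7)
    by (subst sum_nonneg_eq_0_iff[OF fin eps_ge]) (use eps_eq_0_iff[OF deg_ge] in auto)
  have ND: "N + D = int h * int S"
    using sum_eps_eq[OF assms(1), of \<delta> t k]
    unfolding N_def D_def S_def W_def assms(3,4,7) by simp
  have S_le: "2 * S \<le> s * (t * (t + 1))"
    and S_eq: "2 * S = s * (t * (t + 1)) \<longleftrightarrow> (\<forall>i<t. W i = s)"
    unfolding S_def by (rule weighted_sum_bound, rule W_le)+
  have hpos: "h > 0" and tpos: "t > 0" using assms(6,7) by auto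
  \<comment> \<open>Clearing the positive denominator makes both equality claims integer equations;
    \<open>X\<close> will be \<open>N + D\<close> for the first bound and \<open>N\<close> for the
    second.\<close>
  have frac: "real s = 2 * real_of_int X / (real h * real t * (real t + 1))
      \<longleftrightarrow> int h * int (s * (t * (t + 1))) = 2 * X" for X
  proof -
    have "real s = 2 * real_of_int X / (real h * real t * (real t + 1))
      \<longleftrightarrow> real s * (real h * real t * (real t + 1)) = 2 * real_of_int X"
      using hpos tpos by (subst eq_divide_eq) auto
    also have "real s * (real h * real t * (real t + 1)) = real_of_int (int h * int (s * (t * (t + 1))))"
      by (simp add: algebra_simps)
    also have "2 * real_of_int X = real_of_int (2 * X)" by simp
    also have "real_of_int (int h * int (s * (t * (t + 1)))) = \<dots> \<longleftrightarrow> int h * int (s * (t * (t + 1))) = 2 * X"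
      by (rule of_int_eq_iff)
    finally show ?thesis by (simp only: of_int_mult of_int_numeral)
  qed
  have N_real: "real n * (real \<delta> + real t * real h) - 2 * real m = real_of_int N"
    by (simp add: N_def)
  have D_real: "(\<Sum>v\<in>V. real_of_int (eps \<delta> k t (degree E v))) = real_of_int D"
    by (simp add: D_def)
  have f: "f_bound n m \<delta> k t = 2 * real_of_int N / (real h * real t * (real t + 1))"
    unfolding f_bound_def N_real[symmetric] assms(7) ..
  have "int h * int (s * (t * (t + 1))) = 2 * (N + D) \<longleftrightarrow> int h * int (s * (t * (t + 1))) = int h * int (2 * S)"
    unfolding ND by simp
  also have "\<dots> \<longleftrightarrow> 2 * S = s * (t * (t + 1))"
    using hpos unfolding mult_cancel_left of_nat_eq_iff by auto
  finally have bound_eq: "int h * int (s * (t * (t + 1))) = 2 * (N + D) \<longleftrightarrow> (\<forall>i<t. W i = s)"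
    using S_eq by simp
  have part1: "real s = 2 * (real n * (real \<delta> + real t * real h) - 2 * real m
        + (\<Sum>v\<in>V. real_of_int (eps \<delta> k t (degree E v)))) / (real h * real t * (real t + 1))
      \<longleftrightarrow> (\<forall>i<t. window_count V E \<delta> k i = s)"
    unfolding N_real D_real of_int_add[symmetric] frac bound_eq W_def ..
  have "int h * int (2 * S) \<le> int h * int (s * (t * (t + 1)))"
    using S_le by (intro mult_left_mono iffD2[OF of_nat_le_iff]) simp_all
  then have "2 * (N + D) \<le> int h * int (s * (t * (t + 1)))" unfolding ND by simp
  \<comment> \<open>In the chain 2 N \<le> 2 (N + D) \<le> h s t (t + 1), the outer terms agree
    exactly when both inequalities are equalities.\<close>
  then have f_eq: "real s = f_bound n m \<delta> k t \<longleftrightarrow> D = 0 \<and> (\<forall>i<t. W i = s)"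
    unfolding f frac bound_eq[symmetric] using D_nonneg by auto
  \<comment> \<open>The only number of the form \<delta> + j h in window \<open>i\<close> is its
    left end, so \<open>W i\<close> counts a single degree, and the degree classes for i \<le> t
    partition \<open>V\<close>.\<close>
  have struct: "(\<forall>i\<le>t. W i = num_of_degree V E (\<delta> + i * h)) \<and> n = (\<Sum>i\<le>t. W i)"
    if deg: "\<forall>v\<in>V. degree E v \<in> {\<delta> + i * h | i. i \<le> t}"
  proof
    have iff: "degree E v \<in> window \<delta> k i \<longleftrightarrow> degree E v = \<delta> + i * h" if v: "v \<in> V" for v i
    proof -
      from deg v obtain j where j: "degree E v = \<delta> + j * h" by auto
      have "j * h div h = j" using hpos by simp
      then show ?thesis
        unfolding j mem_window_iff[OF le_add1] add_diff_cancel_left' assms(7)[symmetric]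
        using hpos by auto
    qed
    show W_eq: "\<forall>i\<le>t. W i = num_of_degree V E (\<delta> + i * h)"
      unfolding W_def window_count_eq_card[OF fin] num_of_degree_def
      using iff by (auto intro!: arg_cong[where f = card])
    have "V = (\<Union>i\<in>{..t}. {v \<in> V. degree E v = \<delta> + i * h})" using deg by auto
    then have "n = card (\<Union>i\<in>{..t}. {v \<in> V. degree E v = \<delta> + i * h})" using assms(3) by simp
    also have "\<dots> = (\<Sum>i\<le>t. card {v \<in> V. degree E v = \<delta> + i * h})"
      by (rule card_UN_disjoint) (use fin hpos in auto)
    also have "\<dots> = (\<Sum>i\<le>t. W i)" using W_eq by (simp add: num_of_degree_def)
    finally show "n = (\<Sum>i\<le>t. W i)" .
  qed
  \<comment> \<open>The first \<open>t\<close> windows hold \<open>s\<close> vertices each and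
    window \<open>t\<close> holds the rest. As a window count, \<open>W t\<close> is also at most
    \<open>s\<close>.\<close>
  have last: "n = t * s + num_of_degree V E (\<delta> + t * h) \<and> num_of_degree V E (\<delta> + t * h) \<le> s"
    if "D = 0" "\<forall>i<t. W i = s"
  proof -
    note * = struct[OF D_0[THEN iffD1, OF that(1)]]
    have "(\<Sum>i\<le>t. W i) = t * s + W t"
      using that(2) by (simp add: lessThan_Suc_atMost[symmetric])
    moreover have "W t = num_of_degree V E (\<delta> + t * h)" using * by blast
    ultimately show ?thesis using * W_le[of t] by linarith
  qed
  have part2: "real s = f_bound n m \<delta> k t
        \<longleftrightarrow> (\<forall>v\<in>V. degree E v \<in> {\<delta> + i * h | i. i \<le> t})
            \<and> (\<forall>i<t. num_of_degree V E (\<delta> + i * h) = s)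
            \<and> int (num_of_degree V E (\<delta> + t * h)) = int n - int t * int s
            \<and> int n - int t * int s \<le> int s" (is "_ \<longleftrightarrow> ?deg \<and> ?rest")
  proof
    assume "real s = f_bound n m \<delta> k t"
    then have *: "D = 0" "\<forall>i<t. W i = s" using f_eq by auto
    have deg: ?deg using * D_0 by blast
    have "int (num_of_degree V E (\<delta> + t * h)) = int n - int t * int s"
      "int n - int t * int s \<le> int s"
      using last[OF *] by auto
    moreover have "\<forall>i<t. num_of_degree V E (\<delta> + i * h) = s"
      using struct[OF deg] *(2) by simp
    ultimately show "?deg \<and> ?rest" using deg by blast
  next
    assume *: "?deg \<and> ?rest"
    then have "\<forall>i<t. W i = s" using struct by simp
    with * show "real s = f_bound n m \<delta> k t" using f_eq D_0 by blast
  qed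
  have part3: "f_bound n m \<delta> k t \<in> \<int>
            \<and> real n / (real t + 1) \<le> real s \<and> real s \<le> real n / real t
            \<and> real t - 1 \<le> 2 * x_param n m \<delta> k \<and> 2 * x_param n m \<delta> k \<le> real t"
    if eq: "real s = f_bound n m \<delta> k t"
  proof -
    define x where "x = x_param n m \<delta> k"
    have "t * s \<le> n" "n \<le> (t + 1) * s" using last eq f_eq by auto
    then have "real (t * s) \<le> real n" "real n \<le> real ((t + 1) * s)" by (simp_all only: of_nat_le_iff)
    then have ts: "real t * real s \<le> real n" and ns: "real n \<le> (real t + 1) * real s"
      by (simp_all add: distrib_right)
    have "real s = 2 * real n * (real t - x) / (real t * (real t + 1))"
      unfolding eq x_def by (rule f_bound_eq_x_param[OF npos])
    then have sx: "real s * (real t * (real t + 1)) = real n * (2 * (real t - x))"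
      using tpos by (simp add: eq_divide_eq)
    \<comment> \<open>Multiplying t s \<le> n by t + 1, and below n \<le> (t + 1) s by t, and then
      cancelling n, puts 2 (t - x) between t and t + 1; this is t - 1 \<le> 2 x \<le> t.\<close>
    have "real n * (2 * (real t - x)) \<le> real n * (real t + 1)"
      unfolding sx[symmetric] using mult_right_mono[OF ts, of "real t + 1"] by (simp add: algebra_simps)
    then have "2 * (real t - x) \<le> real t + 1" using npos by (simp add: mult_le_cancel_left)
    moreover have "real n * real t \<le> real n * (2 * (real t - x))"
      unfolding sx[symmetric] using mult_right_mono[OF ns, of "real t"] by (simp add: algebra_simps)
    then have "real t \<le> 2 * (real t - x)" using npos by (simp add: mult_le_cancel_left)
    moreover have "f_bound n m \<delta> k t \<in> \<int>" unfolding eq[symmetric] by simp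
    ultimately show ?thesis
      using ts ns tpos unfolding x_def by (simp add: field_simps)
  qed
  show ?thesis using part1 part2 part3 by blast
qed

end
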